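(* For every $k \ge 1$, the matrix $\mathbf{A}^{\mathrm{M}}_k$ generated by the structured BFGS-Minus recursion $$\mathbf{A}^{\mathrm{M}}_{i+1} = \mathbf{B}^{\mathrm{M}}_i - \mathbf{K}_{i+1} - \frac{1}{\mathbf{s}_i^T\mathbf{B}^{\mathrm{M}}_i\mathbf{s}_i}\,\mathbf{B}^{\mathrm{M}}_i\mathbf{s}_i\mathbf{s}_i^T\mathbf{B}^{\mathrm{M}}_i + \frac{1}{\mathbf{s}_i^T\mathbf{u}_i}\,\mathbf{u}_i\mathbf{u}_i^T,\qquad \mathbf{B}^{\mathrm{M}}_i = \mathbf{A}^{\mathrm{M}}_i + \mathbf{K}_i,\qquad i \ge 0,$$ has the compact representation $$\mathbf{A}^{\mathrm{M}}_k = \mathbf{B}^{\mathrm{M}}_0 - \mathbf{K}_k - \begin{bmatrix} \mathbf{B}^{\mathrm{M}}_0\mathbf{S}_k & \mathbf{U}_k\end{bmatrix}\begin{bmatrix}\mathbf{S}_k^T\mathbf{B}^{\mathrm{M}}_0\mathbf{S}_k & \mathbf{L}^{\mathrm{U}}_k\\ (\mathbf{L}^{\mathrm{U}}_k)^T & -\mathbf{D}^{\mathrm{U}}_k\end{bmatrix}^{-1}\begin{bmatrix}\mathbf{S}_k^T(\mathbf{B}^{\mathrm{M}}_0)^T\\ \mathbf{U}_k^T\end{bmatrix},$$ where $\mathbf{B}^{\mathrm{M}}_0 = \mathbf{A}^{\mathrm{M}}_0 + \mathbf{K}_0$.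
   Context: Setting: $f = \widehat{k} + \widehat{u}$ with $\widehat{k},\widehat{u}:\mathbb{R}^n\to\mathbb{R}$ twice continuously differentiable; $\mathbf{x}_0,\mathbf{x}_1,\dots$ is a sequence of points in $\mathbb{R}^n$. For $i\ge 0$ put $\mathbf{s}_i = \mathbf{x}_{i+1}-\mathbf{x}_i$, $\mathbf{K}_i = \nabla^2\widehat{k}(\mathbf{x}_i)\in\mathbb{R}^{n\times n}$ (symmetric), and $$\mathbf{u}_i = \mathbf{K}_{i+1}\mathbf{s}_i + \left(\nabla\widehat{u}(\mathbf{x}_{i+1}) - \nabla\widehat{u}(\mathbf{x}_i)\right).$$ The initial matrix $\mathbf{A}^{\mathrm{M}}_0\in\mathbb{R}^{n\times n}$ is given, and it is assumed that $\mathbf{B}^{\mathrm{M}}_0=\mathbf{A}^{\mathrm{M}}_0+\mathbf{K}_0$ is symmetric positive definite and that $\mathbf{s}_i^T\mathbf{u}_i>0$ for all $i\ge 0$. For $k\ge1$: $\mathbf{S}_k = [\mathbf{s}_0,\dots,\mathbf{s}_{k-1}]\in\mathbb{R}^{n\times k}$ and $\mathbf{U}_k = [\mathbf{u}_0,\dots,\mathbf{u}_{k-1}]\in\mathbb{R}^{n\times k}$. Write $\mathbf{S}_k^T\mathbf{U}_k = \mathbf{L}^{\mathrm{U}}_k + \mathbf{R}^{\mathrm{U}}_k$ where $\mathbf{L}^{\mathrm{U}}_k\in\mathbb{R}^{k\times k}$ is strictly lower triangular and $\mathbf{R}^{\mathrm{U}}_k\in\mathbb{R}^{k\times k}$ is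 upper triangular (including the diagonal); $\mathbf{D}^{\mathrm{U}}_k\in\mathbb{R}^{k\times k}$ is the diagonal matrix formed from the diagonal of $\mathbf{S}_k^T\mathbf{U}_k$. *)

theory Defs
  imports "HOL-Analysis.Analysis"
begin

definition grad :: "('a::real_inner \<Rightarrow> real) \<Rightarrow> 'a \<Rightarrow> 'a" where
  "grad f x = (THE D. GDERIV f x :> D)"

lemma grad_eqI:
  assumes "GDERIV f x :> D"
  shows "grad f x = D"
  unfolding grad_def
proof (rule the_equality[where P = "\<lambda>D. GDERIV f x :> D", OF assms])
  fix D' assume "GDERIV f x :> D'"
  then have "(\<lambda>h. inner h D') = (\<lambda>h. inner h D)"
    using assms unfolding gderiv_def by (rule has_derivative_unique)
  then have "inner h D' = inner h D" for h
    by (rule fun_cong)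
  then show "D' = D"
    using vector_eq_ldot by blast
qed

definition hessian :: "(real^'n \<Rightarrow> real) \<Rightarrow> real^'n \<Rightarrow> real^'n^'n" where
  "hessian f x = jacobian (grad f) (at x)"

definition twice_continuously_differentiable :: "(real^'n \<Rightarrow> real) \<Rightarrow> bool" where
  "twice_continuously_differentiable f \<longleftrightarrow>
     (\<forall>x. f differentiable at x) \<and> (\<forall>x. grad f differentiable at x) \<and>
     continuous_on UNIV (hessian f)"

definition symmetric_positive_definite :: "real^'n^'n \<Rightarrow> bool" where
  "symmetric_positive_definite B \<longleftrightarrow>
     transpose B = B \<and> (\<forall>v. v \<noteq> 0 \<longrightarrow> v \<bullet> (B *v v) > 0)"

text \<open>The product \<open>v w\<^sup>T\<close> of a column and a row.\<close>

definition outer :: "real^'m \<Rightarrow> real^'n \<Rightarrow> real^'n^'m" where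
  "outer v w = (\<chi> i j. v $ i * w $ j)"

text \<open>
  A number \<open>k \<ge> 1\<close> of columns is represented by a linearly ordered index type \<open>'k\<close> with
  \<open>k\<close> elements. The elements of \<open>'k\<close>, in increasing order, have positions \<open>0, \<dots>, k - 1\<close>.
\<close>

definition pos :: "'k::{finite,linorder} \<Rightarrow> nat" where
  "pos j = card {i. i < j}"

lemma pos_strict_mono: "i < j \<Longrightarrow> pos i < pos j"
  unfolding pos_def by (rule psubset_card_mono) auto

lemma pos_bij: "bij_betw (pos :: 'k::{finite,linorder} \<Rightarrow> nat) UNIV {..<CARD('k)}"
proof -
  have inj: "inj (pos :: 'k \<Rightarrow> nat)"
    by (rule injI) (metis less_irrefl linorder_neqE pos_strict_mono)
  have "pos j < CARD('k)" for j :: 'k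
    unfolding pos_def by (rule psubset_card_mono) auto
  then have "range (pos :: 'k \<Rightarrow> nat) \<subseteq> {..<CARD('k)}"
    by auto
  then have "range (pos :: 'k \<Rightarrow> nat) = {..<CARD('k)}"
    by (intro card_subset_eq) (simp_all add: card_image inj)
  with inj show ?thesis
    by (simp add: bij_betw_def)
qed

text \<open>The matrix \<open>[v\<^sub>0, \<dots>, v\<^bsub>k-1\<^esub>]\<close>.\<close>

definition columns_mat :: "(nat \<Rightarrow> real^'n) \<Rightarrow> real^('k::{finite,linorder})^'n" where
  "columns_mat v = (\<chi> i j. v (pos j) $ i)"

definition strictly_lower_triangular :: "real^('k::{finite,linorder})^('k::{finite,linorder}) \<Rightarrow> bool" where
  "strictly_lower_triangular M \<longleftrightarrow> (\<forall>i j. i \<le> j \<longrightarrow> M $ i $ j = 0)"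

definition upper_triangular :: "real^('k::{finite,linorder})^('k::{finite,linorder}) \<Rightarrow> bool" where
  "upper_triangular M \<longleftrightarrow> (\<forall>i j. j < i \<longrightarrow> M $ i $ j = 0)"

definition diagonal_part :: "real^'k^'k \<Rightarrow> real^'k^'k" where
  "diagonal_part M = (\<chi> i j. if i = j then M $ i $ j else 0)"

text \<open>Juxtaposition \<open>[A B]\<close> of blocks in a row, and stacking of \<open>A\<close> on top of \<open>B\<close>.\<close>

definition hcat :: "real^'k^'m \<Rightarrow> real^'l^'m \<Rightarrow> real^('k + 'l)^'m" where
  "hcat A B = (\<chi> i j. case j of Inl a \<Rightarrow> A $ i $ a | Inr b \<Rightarrow> B $ i $ b)"

definition vcat :: "real^'m^'k \<Rightarrow> real^'m^'l \<Rightarrow> real^'m^('k + 'l)" where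
  "vcat A B = (\<chi> i j. case i of Inl a \<Rightarrow> A $ a $ j | Inr b \<Rightarrow> B $ b $ j)"

end

theory Submission
  imports Defs
begin

text \<open>
  The matrices \<open>B i = A i + K i\<close> satisfy the ordinary BFGS recursion, because \<open>K (i + 1)\<close> cancels;
  so the claim is the compact representation of \<open>B k\<close> for BFGS updates with curvature
  \<open>s i \<bullet> u i > 0\<close>. It suffices to compute \<open>B k *v w\<close> for a fixed vector \<open>w\<close>.

  One update is \<open>B' *v w = B *v P w + (u \<bullet> w / (s \<bullet> u)) u\<close>, where \<open>P w = w - a s\<close> is the
  projection along \<open>s\<close> for which \<open>s \<bullet> (B *v P w) = 0\<close>. Peeling off the updates from the
  last one down gives residuals \<open>r k = w\<close> and \<open>r i = r (i + 1) - p i s i\<close> with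
  \<open>s i \<bullet> (B i *v r i) = 0\<close>, and with \<open>q i = - (u i \<bullet> r (i + 1)) / (s i \<bullet> u i)\<close> the recursion becomes
  \<open>B (i + 1) *v r (i + 1) = B i *v r i - q i u i\<close>. Telescoping yields
  \<open>B k *v w = B 0 *v (w - S p) - U q\<close>. The definition of \<open>q\<close> is the second block row of the
  linear system \<open>M (p, q) = (S\<^sup>T B\<^sub>0 w, U\<^sup>T w)\<close>. The orthogonality relations, with
  \<open>B i *v r i\<close> replaced by its telescoped form, are the first block row. Triangularity appears since
  \<open>r (i + 1)\<close> involves only the later steps and \<open>B i *v r i\<close> only the earlier vectors \<open>u j\<close>.
  This is \<open>bfgs_iterate_mult_vec\<close>, and \<open>compact_representation_mult_vec\<close> in matrix form.

  Two facts about definiteness complete the argument. Updates preserve positivity of the quadratic form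
  (\<open>bfgs_update_positive\<close>), so no denominator \<open>s i \<bullet> (B i *v s i)\<close> vanishes. And \<open>M\<close> is invertible
  even when the steps \<open>s i\<close> are linearly dependent (\<open>middle_matrix_invertible\<close>), so that \<open>(p, q)\<close> is
  obtained from the right-hand side by \<open>matrix_inv M\<close>.
\<close>

section \<open>One BFGS step\<close>

definition bfgs_update :: "real^'n^'n \<Rightarrow> real^'n \<Rightarrow> real^'n \<Rightarrow> real^'n^'n" where
  "bfgs_update B s u =
     B - (1 / (s \<bullet> (B *v s))) *\<^sub>R (B ** outer s s ** B) + (1 / (s \<bullet> u)) *\<^sub>R outer u u"

lemma outer_mult_vec: "outer v w *v x = (w \<bullet> x) *\<^sub>R v"
  by (simp add: vec_eq_iff outer_def matrix_vector_mult_def inner_vec_def sum_distrib_left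
      mult_ac)

text \<open>
  Absorbing the negative rank-one correction into a projection of the argument is what makes the
  recursion telescope below.
\<close>

lemma bfgs_update_mult_vec:
  "bfgs_update B s u *v w =
     B *v (w - (s \<bullet> (B *v w) / (s \<bullet> (B *v s))) *\<^sub>R s) + (u \<bullet> w / (s \<bullet> u)) *\<^sub>R u"
  by (simp add: bfgs_update_def matrix_vector_mult_add_rdistrib
      matrix_vector_mult_diff_rdistrib matrix_vector_mult_diff_distrib
      scaleR_matrix_vector_assoc[symmetric] matrix_vector_mult_scaleR outer_mult_vec
      matrix_vector_mul_assoc[symmetric])

lemma bfgs_projection_annihilates:
  fixes B :: "real^'n^'n"
  assumes "s \<bullet> (B *v s) \<noteq> 0"
  shows "s \<bullet> (B *v (w - (s \<bullet> (B *v w) / (s \<bullet> (B *v s))) *\<^sub>R s)) = 0"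
  using assms by (simp add: matrix_vector_mult_diff_distrib matrix_vector_mult_scaleR inner_diff_right)

text \<open>
  Along \<open>v = y + a s\<close> with \<open>s \<bullet> (B *v y) = 0\<close>, the new quadratic form is the old one at \<open>y\<close> plus
  \<open>(u \<bullet> v)\<^sup>2 / (s \<bullet> u)\<close>. Both summands vanish only if \<open>y = 0\<close> and \<open>u \<bullet> v = a (s \<bullet> u) = 0\<close>,
  hence only if \<open>v = 0\<close>.
\<close>

lemma bfgs_update_positive:
  assumes pos: "\<And>v. v \<noteq> 0 \<Longrightarrow> v \<bullet> (B *v v) > 0" and su: "s \<bullet> u > 0" and "v \<noteq> 0"
  shows "v \<bullet> (bfgs_update B s u *v v) > 0"
proof -
  have "s \<noteq> 0" using su by auto
  then have sBs: "s \<bullet> (B *v s) > 0" by (rule pos)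
  define a where "a = s \<bullet> (B *v v) / (s \<bullet> (B *v s))"
  define y where "y = v - a *\<^sub>R s"
  have v: "v = y + a *\<^sub>R s" by (simp add: y_def)
  have "s \<bullet> (B *v y) = 0"
    unfolding y_def a_def using sBs by (intro bfgs_projection_annihilates) simp
  then have "v \<bullet> (B *v y) = y \<bullet> (B *v y)"
    by (subst v) (simp add: inner_add_left)
  then have eq: "v \<bullet> (bfgs_update B s u *v v) = y \<bullet> (B *v y) + (u \<bullet> v)\<^sup>2 / (s \<bullet> u)"
    by (simp add: bfgs_update_mult_vec inner_add_right a_def[symmetric] y_def[symmetric]
        inner_commute power2_eq_square)
  show ?thesis
  proof (cases "y = 0")
    case True
    then have "v = a *\<^sub>R s" using v by simp
    with \<open>v \<noteq> 0\<close> su have "u \<bullet> v \<noteq> 0" by (auto simp: inner_commute)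
    with su show ?thesis by (simp add: eq True)
  next
    case False
    have "(u \<bullet> v)\<^sup>2 / (s \<bullet> u) \<ge> 0" using su by simp
    with pos[OF False] show ?thesis by (simp add: eq)
  qed
qed

section \<open>The iterated update applied to a vector\<close>

text \<open>
  The coefficients arise from the last step downwards: \<open>p (k - 1)\<close> projects \<open>w\<close>, then \<open>p (k - 2)\<close>
  projects the result, and so on. For this reason the induction on \<open>k\<close> varies \<open>w\<close>.
\<close>

lemma backward_coefficients_exist:
  fixes B :: "nat \<Rightarrow> real^'n^'n" and s :: "nat \<Rightarrow> real^'n"
  assumes "\<And>i. s i \<bullet> (B i *v s i) \<noteq> 0"
  shows "\<exists>p. \<forall>i<k. s i \<bullet> (B i *v (w - (\<Sum>j=i..<k. p j *\<^sub>R s j))) = 0"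
proof (induction k arbitrary: w)
  case 0
  show ?case by simp
next
  case (Suc k)
  define a where "a = s k \<bullet> (B k *v w) / (s k \<bullet> (B k *v s k))"
  from Suc[of "w - a *\<^sub>R s k"] obtain p
    where p: "\<And>i. i < k \<Longrightarrow> s i \<bullet> (B i *v (w - a *\<^sub>R s k - (\<Sum>j=i..<k. p j *\<^sub>R s j))) = 0"
    by blast
  have sum: "w - (\<Sum>j=i..<Suc k. (p(k := a)) j *\<^sub>R s j)
      = w - a *\<^sub>R s k - (\<Sum>j=i..<k. p j *\<^sub>R s j)" if "i \<le> k" for i
    using that by simp
  have "s i \<bullet> (B i *v (w - (\<Sum>j=i..<Suc k. (p(k := a)) j *\<^sub>R s j))) = 0" if "i < Suc k" for i
  proof (cases "i = k")
    case True
    show ?thesis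
      unfolding True sum[OF order_refl] a_def
      by (simp add: bfgs_projection_annihilates assms)
  next
    case False
    with that have "i < k" by simp
    then show ?thesis unfolding sum[OF less_imp_le, OF \<open>i < k\<close>] by (rule p)
  qed
  then show ?case by blast
qed

text \<open>
  The two families of scalar equations are the rows of the linear system for \<open>(p, q)\<close>. Their sums
  over \<open>j < i\<close> and \<open>j > i\<close> are the products with the strictly lower triangular part of
  \<open>S\<^sup>T U\<close> and with its transpose.
\<close>

lemma bfgs_iterate_mult_vec:
  fixes B :: "nat \<Rightarrow> real^'n^'n" and s u :: "nat \<Rightarrow> real^'n"
  assumes step: "\<And>i. B (Suc i) = bfgs_update (B i) (s i) (u i)"
    and sBs: "\<And>i. s i \<bullet> (B i *v s i) \<noteq> 0"
    and su: "\<And>i. s i \<bullet> u i \<noteq> 0"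
  obtains p q where
    "\<And>i. i < k \<Longrightarrow> s i \<bullet> (B 0 *v (w - (\<Sum>j<k. p j *\<^sub>R s j))) = (\<Sum>j<i. (s i \<bullet> u j) * q j)"
    "\<And>i. i < k \<Longrightarrow> (\<Sum>j=Suc i..<k. (s j \<bullet> u i) * p j) - (s i \<bullet> u i) * q i = u i \<bullet> w"
    "B k *v w = B 0 *v (w - (\<Sum>j<k. p j *\<^sub>R s j)) - (\<Sum>j<k. q j *\<^sub>R u j)"
proof -
  obtain p where p: "\<And>i. i < k \<Longrightarrow> s i \<bullet> (B i *v (w - (\<Sum>j=i..<k. p j *\<^sub>R s j))) = 0"
    using backward_coefficients_exist[of s B k w] sBs by blast
  define r where "r i = w - (\<Sum>j=i..<k. p j *\<^sub>R s j)" for i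
  define q where "q i = - (u i \<bullet> r (Suc i)) / (s i \<bullet> u i)" for i
  have r0: "r 0 = w - (\<Sum>j<k. p j *\<^sub>R s j)"
    by (simp add: r_def lessThan_atLeast0)
  have rk: "r k = w" by (simp add: r_def)
  have orth: "s i \<bullet> (B i *v r i) = 0" if "i < k" for i
    using p[OF that] by (simp add: r_def)
  have r_step: "r i = r (Suc i) - p i *\<^sub>R s i" if "i < k" for i
    using that by (simp add: r_def sum.atLeast_Suc_lessThan)
  have p_eq: "p i = s i \<bullet> (B i *v r (Suc i)) / (s i \<bullet> (B i *v s i))" if "i < k" for i
    using orth[OF that] sBs[of i]
    by (simp add: r_step[OF that] matrix_vector_mult_diff_distrib matrix_vector_mult_scaleR
        inner_diff_right field_simps)
  have B_step: "B (Suc i) *v r (Suc i) = B i *v r i - q i *\<^sub>R u i" if "i < k" for i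
    by (simp add: step bfgs_update_mult_vec p_eq[OF that, symmetric] r_step[OF that, symmetric]
        q_def)
  have telescope: "B i *v r i = B 0 *v r 0 - (\<Sum>j<i. q j *\<^sub>R u j)" if "i \<le> k" for i
    using that by (induction i) (simp_all add: B_step)
  show thesis
  proof
    fix i assume i: "i < k"
    have "0 = s i \<bullet> (B 0 *v r 0 - (\<Sum>j<i. q j *\<^sub>R u j))"
      using orth[OF i] telescope[of i] i by simp
    then show "s i \<bullet> (B 0 *v (w - (\<Sum>j<k. p j *\<^sub>R s j))) = (\<Sum>j<i. (s i \<bullet> u j) * q j)"
      by (simp add: r0 inner_diff_right inner_sum_right mult.commute)
    have "(s i \<bullet> u i) * q i = - (u i \<bullet> r (Suc i))"
      using su[of i] by (simp add: q_def)
    then show "(\<Sum>j=Suc i..<k. (s j \<bullet> u i) * p j) - (s i \<bullet> u i) * q i = u i \<bullet> w"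
      by (simp add: r_def inner_diff_right inner_sum_right mult.commute inner_commute)
  next
    show "B k *v w = B 0 *v (w - (\<Sum>j<k. p j *\<^sub>R s j)) - (\<Sum>j<k. q j *\<^sub>R u j)"
      using telescope[of k] by (simp add: rk r0)
  qed
qed

section \<open>Block vectors and matrices of columns\<close>

definition block_vec :: "real^'k \<Rightarrow> real^'l \<Rightarrow> real^('k + 'l)" where
  "block_vec p q = (\<chi> i. case i of Inl a \<Rightarrow> p $ a | Inr b \<Rightarrow> q $ b)"

lemma matrix_inv_mult_left:
  fixes M :: "'a::semiring_1^'n^'m"
  assumes "invertible M"
  shows "matrix_inv M ** M = mat 1"
  using someI_ex[OF assms[unfolded invertible_def]] by (simp add: matrix_inv_def)

lemma block_vec_cases:
  obtains p q where "y = block_vec p q"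
proof
  show "y = block_vec (\<chi> a. y $ Inl a) (\<chi> b. y $ Inr b)"
    by (simp add: block_vec_def vec_eq_iff split: sum.split)
qed

lemma block_vec_eq_iff: "block_vec p q = block_vec p' q' \<longleftrightarrow> p = p' \<and> q = q'"
proof
  assume eq: "block_vec p q = block_vec p' q'"
  have "p $ a = p' $ a" for a
    using arg_cong[OF eq, of "\<lambda>v. v $ Inl a"] by (simp add: block_vec_def)
  moreover have "q $ b = q' $ b" for b
    using arg_cong[OF eq, of "\<lambda>v. v $ Inr b"] by (simp add: block_vec_def)
  ultimately show "p = p' \<and> q = q'" by (simp add: vec_eq_iff)
qed simp

lemma vcat_mult_vec: "vcat A B *v w = block_vec (A *v w) (B *v w)"
  by (simp add: vec_eq_iff vcat_def block_vec_def matrix_vector_mult_def split: sum.split)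

lemma hcat_mult_block_vec: "hcat A B *v block_vec p q = A *v p + B *v q"
  by (simp add: vec_eq_iff hcat_def block_vec_def matrix_vector_mult_def
      UNIV_Plus_UNIV[symmetric] sum.Plus del: UNIV_Plus_UNIV)

lemma uminus_matrix_mult_vec:
  fixes N :: "real^'n^'m"
  shows "(- N) *v q = - (N *v q)"
  by (simp add: vec_eq_iff matrix_vector_mult_def sum_negf)

lemma columns_mat_mult_vec: "columns_mat v *v p = (\<Sum>j\<in>UNIV. p $ j *\<^sub>R v (pos j))"
  by (simp add: vec_eq_iff columns_mat_def matrix_vector_mult_def sum_component mult.commute)

lemma transpose_columns_mat_mult_vec: "(transpose (columns_mat v) *v w) $ j = v (pos j) \<bullet> w"
  by (simp add: columns_mat_def transpose_def matrix_vector_mult_def inner_vec_def)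

lemma transpose_columns_mat_mult_columns_mat:
  "(transpose (columns_mat v) ** columns_mat w) $ i $ j = v (pos i) \<bullet> w (pos j)"
  by (simp add: columns_mat_def transpose_def matrix_matrix_mult_def inner_vec_def)

lemma pos_less_iff: "pos i < pos j \<longleftrightarrow> i < j"
  by (metis linorder_neqE order_less_asym pos_strict_mono)

lemma sum_over_pos:
  "(\<Sum>j\<in>(UNIV :: 'k::{finite,linorder} set). g (pos j)) = (\<Sum>n<CARD('k). g n)"
  by (rule sum.reindex_bij_betw[OF pos_bij])

lemma pos_less_card: "pos (j :: 'k::{finite,linorder}) < CARD('k)"
  using pos_bij by (auto simp: bij_betw_def)

lemma sum_over_pos_below:
  fixes i :: "'k::{finite,linorder}" and g :: "nat \<Rightarrow> real"
  shows "(\<Sum>j\<in>UNIV. if j < i then g (pos j) else 0) = (\<Sum>n<pos i. g n)"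
proof -
  have "(\<Sum>j\<in>UNIV. if j < i then g (pos j) else 0)
      = (\<Sum>n<CARD('k). if n < pos i then g n else 0)"
    by (simp add: sum_over_pos[symmetric] pos_less_iff)
  also have "\<dots> = (\<Sum>n\<in>{n \<in> {..<CARD('k)}. n < pos i}. g n)"
    by (rule sum.inter_filter[symmetric]) simp
  also have "{n \<in> {..<CARD('k)}. n < pos i} = {..<pos i}"
    using pos_less_card[of i] by auto
  finally show ?thesis .
qed

lemma sum_over_pos_above:
  fixes i :: "'k::{finite,linorder}" and g :: "nat \<Rightarrow> real"
  shows "(\<Sum>j\<in>UNIV. if i < j then g (pos j) else 0) = (\<Sum>n=Suc (pos i)..<CARD('k). g n)"
proof -
  have "(\<Sum>j\<in>UNIV. if i < j then g (pos j) else 0)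
      = (\<Sum>n<CARD('k). if pos i < n then g n else 0)"
    by (simp add: sum_over_pos[symmetric] pos_less_iff)
  also have "\<dots> = (\<Sum>n\<in>{n \<in> {..<CARD('k)}. pos i < n}. g n)"
    by (rule sum.inter_filter[symmetric]) simp
  also have "{n \<in> {..<CARD('k)}. pos i < n} = {Suc (pos i)..<CARD('k)}"
    by auto
  finally show ?thesis .
qed

section \<open>The middle matrix\<close>

lemma strictly_lower_plus_upper_entries:
  assumes "strictly_lower_triangular L" "upper_triangular R" "N = L + R"
  shows "L $ i $ j = (if j < i then N $ i $ j else 0)"
    and "R $ i $ j = (if j < i then 0 else N $ i $ j)"
  using assms by (auto simp: strictly_lower_triangular_def upper_triangular_def)

lemma diagonal_part_mult_vec: "(diagonal_part N *v q) $ i = N $ i $ i * q $ i"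
  by (simp add: diagonal_part_def matrix_vector_mult_def if_distrib[where f = "\<lambda>x. x * _"] cong: if_cong)

text \<open>
  Forward substitution: row \<open>i\<close> of \<open>R\<^sup>T p = 0\<close> involves only \<open>p $ j\<close> with \<open>j \<le> i\<close>.
\<close>

lemma transpose_upper_triangular_kernel:
  fixes R :: "real^('k::{finite,linorder})^('k::{finite,linorder})"
  assumes R: "upper_triangular R" and diag: "\<And>i. R $ i $ i \<noteq> 0"
    and zero: "transpose R *v p = 0"
  shows "p = 0"
proof -
  have "p $ i = 0" for i
  proof (induction "pos i" arbitrary: i rule: less_induct)
    case less
    have entry: "R $ j $ i * p $ j = (if j = i then R $ i $ i * p $ i else 0)" for j
    proof (cases j i rule: linorder_cases)
      case less1: less
      then have "p $ j = 0" using less pos_strict_mono by blast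
      then show ?thesis using less1 by simp
    qed (use R in \<open>auto simp: upper_triangular_def\<close>)
    have "(transpose R *v p) $ i = (\<Sum>j\<in>UNIV. R $ j $ i * p $ j)"
      by (simp add: transpose_def matrix_vector_mult_def)
    also have "\<dots> = (\<Sum>j\<in>UNIV. if j = i then R $ i $ i * p $ i else 0)"
      by (rule sum.cong[OF refl entry])
    also have "\<dots> = R $ i $ i * p $ i" by simp
    finally show ?case using zero diag[of i] by simp
  qed
  then show ?thesis by (simp add: vec_eq_iff)
qed

text \<open>
  Let \<open>(p, q)\<close> be in the kernel. The second block row says \<open>L\<^sup>T p = D q\<close>, so pairing the first with
  \<open>p\<close> gives \<open>(S p)\<^sup>T B\<^sub>0 (S p) + q\<^sup>T D q = 0\<close>, whence \<open>S p = 0\<close> and \<open>q = 0\<close>. This does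
  not yet give \<open>p = 0\<close>, as \<open>S\<close> may have dependent columns. But \<open>L\<^sup>T p = D q = 0\<close> and
  \<open>(L + R)\<^sup>T p = U\<^sup>T S p = 0\<close>, so \<open>R\<^sup>T p = 0\<close>, and \<open>R\<close> is triangular with a positive diagonal.
\<close>

lemma middle_matrix_invertible:
  fixes B0 :: "real^'n^'n" and S U :: "real^('k::{finite,linorder})^'n"
  assumes posdef: "\<And>v. v \<noteq> 0 \<Longrightarrow> v \<bullet> (B0 *v v) > 0"
    and diag: "\<And>i. (transpose S ** U) $ i $ i > 0"
    and split: "transpose S ** U = L + R"
    and L: "strictly_lower_triangular L" and R: "upper_triangular R"
  shows "invertible (vcat (hcat (transpose S ** B0 ** S) L)
           (hcat (transpose L) (- diagonal_part (transpose S ** U))))"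
    (is "invertible ?M")
proof -
  let ?D = "diagonal_part (transpose S ** U)"
  have "y = 0" if "?M *v y = 0" for y
  proof -
    obtain p q where y: "y = block_vec p q" by (rule block_vec_cases)
    have zero: "(0 :: real^('k + 'k)) = block_vec 0 0"
      by (simp add: block_vec_def vec_eq_iff split: sum.split)
    have "block_vec ((transpose S ** B0 ** S) *v p + L *v q) (transpose L *v p + (- ?D) *v q)
        = block_vec 0 0"
      using that by (simp add: y vcat_mult_vec hcat_mult_block_vec zero)
    then have top: "(transpose S ** B0 ** S) *v p + L *v q = 0"
      and bot: "transpose L *v p + (- ?D) *v q = 0"
      by (simp_all add: block_vec_eq_iff)
    have Lp: "transpose L *v p = ?D *v q"
      using bot by (simp add: uminus_matrix_mult_vec)
    have "0 = p \<bullet> ((transpose S ** B0 ** S) *v p) + p \<bullet> (L *v q)"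
      using top by (metis inner_add_right inner_zero_right)
    also have "p \<bullet> (L *v q) = (transpose L *v p) \<bullet> q"
      by (simp add: dot_lmul_matrix)
    also have "p \<bullet> ((transpose S ** B0 ** S) *v p) = (S *v p) \<bullet> (B0 *v (S *v p))"
      by (simp add: matrix_vector_mul_assoc[symmetric]) (metis dot_lmul_matrix inner_commute transpose_matrix_vector)
    finally have sum0: "(S *v p) \<bullet> (B0 *v (S *v p)) + (?D *v q) \<bullet> q = 0"
      by (simp only: Lp)
    have Dq: "(?D *v q) \<bullet> q = (\<Sum>i\<in>UNIV. (transpose S ** U) $ i $ i * (q $ i)\<^sup>2)"
      by (simp add: inner_vec_def diagonal_part_mult_vec power2_eq_square mult.assoc)
    have term_nonneg: "(transpose S ** U) $ i $ i * (q $ i)\<^sup>2 \<ge> 0" for i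
      using diag[of i] by simp
    have "(S *v p) \<bullet> (B0 *v (S *v p)) \<ge> 0"
      using posdef[of "S *v p"] by (cases "S *v p = 0") auto
    moreover have "(?D *v q) \<bullet> q \<ge> 0"
      unfolding Dq by (intro sum_nonneg term_nonneg)
    ultimately have Sp0: "(S *v p) \<bullet> (B0 *v (S *v p)) = 0" and Dq0: "(?D *v q) \<bullet> q = 0"
      using sum0 by linarith+
    have Sp: "S *v p = 0" using Sp0 posdef[of "S *v p"] by fastforce
    have "\<forall>i. (transpose S ** U) $ i $ i * (q $ i)\<^sup>2 = 0"
      using Dq0 term_nonneg unfolding Dq by (subst (asm) sum_nonneg_eq_0_iff) auto
    then have q: "q = 0" using diag by (auto simp: vec_eq_iff) (metis less_irrefl)
    have "transpose (L + R) *v p = transpose U *v (S *v p)"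
      by (simp add: split[symmetric] matrix_transpose_mul matrix_vector_mul_assoc)
    moreover have "transpose (L + R) = transpose L + transpose R"
      by (simp add: transpose_def vec_eq_iff)
    ultimately have "transpose R *v p = 0"
      using Sp Lp q by (simp add: matrix_vector_mult_add_rdistrib)
    moreover have "R $ i $ i \<noteq> 0" for i
      using strictly_lower_plus_upper_entries(2)[OF L R split, of i i] diag[of i] by simp
    ultimately have "p = 0" using R transpose_upper_triangular_kernel by blast
    then show ?thesis by (simp add: y q zero)
  qed
  then show ?thesis
    unfolding invertible_left_inverse matrix_left_invertible_ker by blast
qed

section \<open>The compact representation\<close>

text \<open>
  The witness \<open>y\<close> consists of the scalars from the unrolled recursion, \<open>p\<close> in the upper block and
  \<open>q\<close> in the lower one.
\<close>

lemma compact_representation_mult_vec: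
  fixes B :: "nat \<Rightarrow> real^'n^'n" and s u :: "nat \<Rightarrow> real^'n"
    and S U :: "real^('k::{finite,linorder})^'n"
  assumes step: "\<And>i. B (Suc i) = bfgs_update (B i) (s i) (u i)"
    and sBs: "\<And>i. s i \<bullet> (B i *v s i) \<noteq> 0"
    and su: "\<And>i. s i \<bullet> u i \<noteq> 0"
    and S: "S = columns_mat s" and U: "U = columns_mat u"
    and split: "transpose S ** U = L + R"
    and L: "strictly_lower_triangular L" and R: "upper_triangular R"
  obtains y where
    "vcat (hcat (transpose S ** B 0 ** S) L) (hcat (transpose L) (- diagonal_part (transpose S ** U)))
       *v y = vcat (transpose S ** B 0) (transpose U) *v w"
    "B (CARD('k)) *v w = B 0 *v w - hcat (B 0 ** S) U *v y"
proof (rule bfgs_iterate_mult_vec[where B = B and s = s and u = u and k = "CARD('k)" and w = w,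
      OF step sBs su])
  let ?k = "CARD('k)"
  fix p q
  assume top: "\<And>i. i < ?k \<Longrightarrow>
        s i \<bullet> (B 0 *v (w - (\<Sum>j<?k. p j *\<^sub>R s j))) = (\<Sum>j<i. (s i \<bullet> u j) * q j)"
    and bot: "\<And>i. i < ?k \<Longrightarrow>
        (\<Sum>j=Suc i..<?k. (s j \<bullet> u i) * p j) - (s i \<bullet> u i) * q i = u i \<bullet> w"
    and Bk: "B ?k *v w = B 0 *v (w - (\<Sum>j<?k. p j *\<^sub>R s j)) - (\<Sum>j<?k. q j *\<^sub>R u j)"
  define P Q :: "real^('k::{finite,linorder})"
    where "P = (\<chi> j. p (pos j))" and "Q = (\<chi> j. q (pos j))"
  have SP: "S *v P = (\<Sum>j<?k. p j *\<^sub>R s j)"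
    by (simp add: S columns_mat_mult_vec P_def sum_over_pos[of "\<lambda>n. p n *\<^sub>R s n"])
  have UQ: "U *v Q = (\<Sum>j<?k. q j *\<^sub>R u j)"
    by (simp add: U columns_mat_mult_vec Q_def sum_over_pos[of "\<lambda>n. q n *\<^sub>R u n"])
  have SU: "(transpose S ** U) $ i $ j = s (pos i) \<bullet> u (pos j)" for i j
    by (simp add: S U transpose_columns_mat_mult_columns_mat)
  have Uw: "(transpose U *v w) $ i = u (pos i) \<bullet> w" for i
    by (simp only: U transpose_columns_mat_mult_vec)
  have Lij: "L $ i $ j = (if j < i then s (pos i) \<bullet> u (pos j) else 0)" for i j
    using strictly_lower_plus_upper_entries(1)[OF L R split] by (simp add: SU)
  have LQ: "(L *v Q) $ i = (\<Sum>n<pos i. (s (pos i) \<bullet> u n) * q n)" for i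
    unfolding sum_over_pos_below[symmetric]
    by (simp add: matrix_vector_mult_def Lij Q_def if_distrib[where f = "\<lambda>x. x * _"] cong: if_cong)
  have LP: "(transpose L *v P) $ i = (\<Sum>n=Suc (pos i)..<?k. (s n \<bullet> u (pos i)) * p n)" for i
    unfolding sum_over_pos_above[symmetric]
    by (simp add: matrix_vector_mult_def transpose_def Lij P_def
        if_distrib[where f = "\<lambda>x. x * _"] cong: if_cong)
  have "((transpose S ** B 0 ** S) *v P + L *v Q) $ i = ((transpose S ** B 0) *v w) $ i" for i
    using top[OF pos_less_card, of i]
    by (simp add: LQ SP[symmetric] matrix_vector_mul_assoc[symmetric] S
        transpose_columns_mat_mult_vec matrix_vector_mult_diff_distrib inner_diff_right
        del: transpose_matrix_vector)
  moreover have "(transpose L *v P + (- diagonal_part (transpose S ** U)) *v Q) $ i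
      = (transpose U *v w) $ i" for i
    using bot[OF pos_less_card, of i]
    by (simp add: LP diagonal_part_mult_vec SU Q_def Uw uminus_matrix_mult_vec
        del: transpose_matrix_vector)
  ultimately have sol: "(transpose S ** B 0 ** S) *v P + L *v Q = (transpose S ** B 0) *v w"
    "transpose L *v P + (- diagonal_part (transpose S ** U)) *v Q = transpose U *v w"
    by (simp_all only: vec_eq_iff simp_thms)
  show thesis
  proof
    show "vcat (hcat (transpose S ** B 0 ** S) L)
        (hcat (transpose L) (- diagonal_part (transpose S ** U))) *v block_vec P Q
        = vcat (transpose S ** B 0) (transpose U) *v w"
      by (simp only: vcat_mult_vec hcat_mult_block_vec sol)
    show "B ?k *v w = B 0 *v w - hcat (B 0 ** S) U *v block_vec P Q"
      by (simp add: hcat_mult_block_vec Bk UQ SP matrix_vector_mul_assoc[symmetric]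
          matrix_vector_mult_diff_distrib)
  qed
qed

theorem theorem1:
  fixes f khat uhat :: "real^'n \<Rightarrow> real"
    and x s u :: "nat \<Rightarrow> real^'n"
    and K A B :: "nat \<Rightarrow> real^'n^'n"
    and S U :: "real^('k::{finite,linorder})^'n"
    and L R D :: "real^('k::{finite,linorder})^('k::{finite,linorder})"
    and M :: "real^('k + 'k)^('k + 'k)"
    and k :: nat
  assumes "f = (\<lambda>z. khat z + uhat z)"
    and "twice_continuously_differentiable khat"
    and "twice_continuously_differentiable uhat"
    and "\<And>i. s i = x (i + 1) - x i"
    and "\<And>i. K i = hessian khat (x i)"
    and "\<And>i. u i = K (i + 1) *v s i + (grad uhat (x (i + 1)) - grad uhat (x i))"
    and "\<And>i. B i = A i + K i"
    and "\<And>i. A (i + 1) = B i - K (i + 1)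
           - (1 / (s i \<bullet> (B i *v s i))) *\<^sub>R (B i ** outer (s i) (s i) ** B i)
           + (1 / (s i \<bullet> u i)) *\<^sub>R outer (u i) (u i)"
    and "symmetric_positive_definite (B 0)"
    and "\<And>i. s i \<bullet> u i > 0"
    and "k \<ge> 1" and "CARD('k) = k"
    and "S = columns_mat s" and "U = columns_mat u"
    and "transpose S ** U = L + R"
    and "strictly_lower_triangular L" and "upper_triangular R"
    and "D = diagonal_part (transpose S ** U)"
    and "M = vcat (hcat (transpose S ** B 0 ** S) L) (hcat (transpose L) (- D))"
  shows "invertible M \<and>
    A k = B 0 - K k
      - hcat (B 0 ** S) U ** matrix_inv M ** vcat (transpose S ** transpose (B 0)) (transpose U)"
proof -
  have step: "B (Suc i) = bfgs_update (B i) (s i) (u i)" for i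
    using assms(7)[of "Suc i"] assms(8)[of i] by (simp add: bfgs_update_def)
  have sym: "transpose (B 0) = B 0"
    and pos0: "\<And>v. v \<noteq> 0 \<Longrightarrow> v \<bullet> (B 0 *v v) > 0"
    using assms(9) by (auto simp: symmetric_positive_definite_def)
  have posdef: "v \<bullet> (B i *v v) > 0" if "v \<noteq> 0" for i v
    using that
  proof (induction i arbitrary: v)
    case 0
    then show ?case by (rule pos0)
  next
    case (Suc i)
    show ?case
      unfolding step by (rule bfgs_update_positive[OF Suc.IH assms(10) Suc.prems])
  qed
  have "s i \<noteq> 0" for i
    using assms(10)[of i] by auto
  then have sBs: "s i \<bullet> (B i *v s i) \<noteq> 0" for i
    using posdef by (metis less_irrefl)
  have su: "s i \<bullet> u i \<noteq> 0" for i
    using assms(10)[of i] by simp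
  have M: "M = vcat (hcat (transpose S ** B 0 ** S) L)
      (hcat (transpose L) (- diagonal_part (transpose S ** U)))"
    using assms(18,19) by simp
  have diag: "(transpose S ** U) $ i $ i > 0" for i
    using assms(10,13,14) by (simp add: transpose_columns_mat_mult_columns_mat)
  have inv: "invertible M"
    unfolding M using pos0 diag assms(15-17) by (rule middle_matrix_invertible)
  have "B k *v w = (B 0
      - hcat (B 0 ** S) U ** matrix_inv M ** vcat (transpose S ** B 0) (transpose U)) *v w" for w
  proof -
    obtain y where y: "M *v y = vcat (transpose S ** B 0) (transpose U) *v w"
      and Bk: "B (CARD('k)) *v w = B 0 *v w - hcat (B 0 ** S) U *v y"
      unfolding M by (rule compact_representation_mult_vec[OF step sBs su assms(13-17), of w])
    have "matrix_inv M *v (M *v y) = y"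
      using matrix_inv_mult_left[OF inv] by (simp add: matrix_vector_mul_assoc)
    then show ?thesis
      using Bk assms(12)
      by (simp add: matrix_vector_mult_diff_rdistrib matrix_vector_mul_assoc[symmetric] y)
  qed
  then have "B k = B 0
      - hcat (B 0 ** S) U ** matrix_inv M ** vcat (transpose S ** B 0) (transpose U)"
    by (simp add: matrix_eq)
  moreover have "A k = B k - K k"
    using assms(7)[of k] by simp
  ultimately show ?thesis
    using inv by (simp add: sym diff_right_commute)
qed

end
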